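(* Let $\Omega\subset\mathbb{C}$ be a domain, let $X\subset\mathcal{H}(\Omega)$ and let $n$ be a positive integer. Assume, in addition, that $X$ is an algebra (with respect to the usual pointwise multiplication of functions) that contains the constant function $1$ and satisfies $X'=X$. Then $\mathcal{Z}_n(X)=\mathcal{Z}(X)$.
   Context: $\mathcal{H}(\Omega)$ is the set of holomorphic functions on $\Omega$, and an algebra is a complex linear subspace closed under multiplication. $X':=\{f':f\in X\}$. A zero of a holomorphic function is called $n$-deep if its multiplicity is at least $n+1$. For linearly independent $f_0,\dots,f_n\in\mathcal{H}(\Omega)$, $\mathcal{Z}(f_0,\dots,f_n)$ is the set of points $z\in\Omega$ for which there exist complex numbers $\lambda_0,\dots,\lambda_n$ (depending on $z$), not all zero, such that $\sum_{j=0}^n\lambda_jf_j$ has an $n$-deep zero at $z$. $\mathcal{Z}_n(X)$ is the collection of those sets $E\subset\Omega$ which can be written as $E=\mathcal{Z}(f_0,\dots,f_n)$ for some linearly independent functions $f_0,\dots,f_n$ in $X$. $\mathcal{Z}(X):=\mathcal{Z}_0(X)$ is the collection of zero sets $g^{-1}(0)$ of non-null functions $g\in X$ (zero sets are sets of points, without multiplicities). *)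

theory Defs
  imports "HOL-Complex_Analysis.Complex_Analysis" "HOL-Library.FuncSet"
begin

(* A function on \<Omega> is represented by its extensional extension (value undefined
   off \<Omega>), so that equality in Hol \<Omega> is equality of functions on \<Omega>. Every
   operation on Hol \<Omega> therefore restricts its result to \<Omega>. *)
definition Hol :: "complex set \<Rightarrow> (complex \<Rightarrow> complex) set" where
  "Hol \<Omega> = {f \<in> extensional \<Omega>. f holomorphic_on \<Omega>}"

definition domain_set :: "complex set \<Rightarrow> bool" where
  "domain_set \<Omega> \<longleftrightarrow> open \<Omega> \<and> connected \<Omega> \<and> \<Omega> \<noteq> {}"

definition is_algebra :: "complex set \<Rightarrow> (complex \<Rightarrow> complex) set \<Rightarrow> bool" where
  "is_algebra \<Omega> X \<longleftrightarrow>
     X \<subseteq> Hol \<Omega> \<and>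
     (\<lambda>z\<in>\<Omega>. 0) \<in> X \<and>
     (\<forall>f\<in>X. \<forall>g\<in>X. (\<lambda>z\<in>\<Omega>. f z + g z) \<in> X) \<and>
     (\<forall>c. \<forall>f\<in>X. (\<lambda>z\<in>\<Omega>. c * f z) \<in> X) \<and>
     (\<forall>f\<in>X. \<forall>g\<in>X. (\<lambda>z\<in>\<Omega>. f z * g z) \<in> X)"

definition deriv_set :: "complex set \<Rightarrow> (complex \<Rightarrow> complex) set \<Rightarrow> (complex \<Rightarrow> complex) set" where
  "deriv_set \<Omega> X = (\<lambda>f. restrict (deriv f) \<Omega>) ` X"

(* The library leaves zorder f z unspecified when f vanishes identically near z;
   the first disjunct gives such a zero infinite multiplicity. *)
definition deep_zero :: "nat \<Rightarrow> (complex \<Rightarrow> complex) \<Rightarrow> complex \<Rightarrow> bool" where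
  "deep_zero n f z \<longleftrightarrow>
     (\<forall>\<^sub>F w in nhds z. f w = 0) \<or> (f z = 0 \<and> zorder f z \<ge> int (n + 1))"

(* Linear independence of the family f 0, ..., f n (in particular, no repetitions). *)
definition lin_indep :: "complex set \<Rightarrow> nat \<Rightarrow> (nat \<Rightarrow> complex \<Rightarrow> complex) \<Rightarrow> bool" where
  "lin_indep \<Omega> n f \<longleftrightarrow>
     (\<forall>c::nat \<Rightarrow> complex. (\<forall>z\<in>\<Omega>. (\<Sum>j\<le>n. c j * f j z) = 0) \<longrightarrow> (\<forall>j\<le>n. c j = 0))"

definition deep_zero_set :: "complex set \<Rightarrow> nat \<Rightarrow> (nat \<Rightarrow> complex \<Rightarrow> complex) \<Rightarrow> complex set" where
  "deep_zero_set \<Omega> n f =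
     {z \<in> \<Omega>. \<exists>c::nat \<Rightarrow> complex. (\<exists>j\<le>n. c j \<noteq> 0) \<and> deep_zero n (\<lambda>w. \<Sum>j\<le>n. c j * f j w) z}"

definition Zn :: "complex set \<Rightarrow> nat \<Rightarrow> (complex \<Rightarrow> complex) set \<Rightarrow> complex set set" where
  "Zn \<Omega> n X = {deep_zero_set \<Omega> n f | f. (\<forall>j\<le>n. f j \<in> X) \<and> lin_indep \<Omega> n f}"

definition Z :: "complex set \<Rightarrow> (complex \<Rightarrow> complex) set \<Rightarrow> complex set set" where
  "Z \<Omega> X = Zn \<Omega> 0 X"

lemma deep_zero_0_iff:
  assumes "open S" "f holomorphic_on S" "z \<in> S"
  shows "deep_zero 0 f z \<longleftrightarrow> f z = 0"
proof
  assume "deep_zero 0 f z"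
  then show "f z = 0"
    unfolding deep_zero_def using eventually_nhds_x_imp_x by blast
next
  assume fz: "f z = 0"
  show "deep_zero 0 f z"
  proof (cases "\<exists>\<^sub>F w in at z. f w \<noteq> 0")
    case True
    then have "zorder f z > 0"
      using zorder_pos_iff[of f S z] assms fz by blast
    with fz show ?thesis by (simp add: deep_zero_def)
  next
    case False
    then have "\<forall>\<^sub>F w in at z. f w = 0" by (simp add: frequently_def)
    with fz have "\<forall>\<^sub>F w in nhds z. f w = 0"
      by (simp add: eventually_nhds_conv_at)
    then show ?thesis by (simp add: deep_zero_def)
  qed
qed

(* Z \<Omega> X consists of the zero sets of the non-null functions in X. *)
lemma Z_eq_zero_sets:
  assumes "open \<Omega>" "X \<subseteq> Hol \<Omega>"
  shows "Z \<Omega> X = {{z \<in> \<Omega>. g z = 0} | g. g \<in> X \<and> (\<exists>z\<in>\<Omega>. g z \<noteq> 0)}"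
proof -
  have ind: "lin_indep \<Omega> 0 f \<longleftrightarrow> (\<exists>z\<in>\<Omega>. f 0 z \<noteq> 0)" for f
  proof
    assume "lin_indep \<Omega> 0 f"
    then show "\<exists>z\<in>\<Omega>. f 0 z \<noteq> 0"
      using iffD1[OF lin_indep_def, THEN spec, of \<Omega> 0 f "\<lambda>_. 1"] by auto
  next
    assume "\<exists>z\<in>\<Omega>. f 0 z \<noteq> 0"
    then show "lin_indep \<Omega> 0 f"
      unfolding lin_indep_def by simp blast
  qed
  have set: "deep_zero_set \<Omega> 0 f = {z \<in> \<Omega>. f 0 z = 0}" if f: "f 0 \<in> X" for f
  proof -
    have hol: "(\<lambda>w. c * f 0 w) holomorphic_on \<Omega>" for c
      using f assms(2) by (auto simp: Hol_def intro!: holomorphic_intros)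
    have *: "deep_zero 0 (\<lambda>w. c * f 0 w) z \<longleftrightarrow> c * f 0 z = 0" if "z \<in> \<Omega>" for c z
      using deep_zero_0_iff[OF assms(1) hol that] .
    have ex: "(\<exists>c::nat \<Rightarrow> complex. c 0 \<noteq> 0 \<and> c 0 * f 0 z = 0) \<longleftrightarrow> f 0 z = 0" for z
    proof
      assume "f 0 z = 0"
      then show "\<exists>c::nat \<Rightarrow> complex. c 0 \<noteq> 0 \<and> c 0 * f 0 z = 0"
        by (intro exI[of _ "\<lambda>_. 1"]) simp
    qed auto
    have "deep_zero_set \<Omega> 0 f =
        {z \<in> \<Omega>. \<exists>c::nat \<Rightarrow> complex. c 0 \<noteq> 0 \<and> deep_zero 0 (\<lambda>w. c 0 * f 0 w) z}"
      by (simp add: deep_zero_set_def)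
    also have "\<dots> = {z \<in> \<Omega>. f 0 z = 0}"
      using * ex by blast
    finally show ?thesis .
  qed
  show ?thesis
  proof (intro set_eqI iffI)
    fix E assume "E \<in> Z \<Omega> X"
    then obtain f where "E = deep_zero_set \<Omega> 0 f" "f 0 \<in> X" "lin_indep \<Omega> 0 f"
      by (auto simp: Z_def Zn_def)
    then show "E \<in> {{z \<in> \<Omega>. g z = 0} | g. g \<in> X \<and> (\<exists>z\<in>\<Omega>. g z \<noteq> 0)}"
      using ind set by blast
  next
    fix E assume "E \<in> {{z \<in> \<Omega>. g z = 0} | g. g \<in> X \<and> (\<exists>z\<in>\<Omega>. g z \<noteq> 0)}"
    then obtain g where g: "E = {z \<in> \<Omega>. g z = 0}" "g \<in> X" "\<exists>z\<in>\<Omega>. g z \<noteq> 0"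
      by blast
    then have "E = deep_zero_set \<Omega> 0 (\<lambda>_. g)" "lin_indep \<Omega> 0 (\<lambda>_. g)"
      using ind[of "\<lambda>_. g"] set[of "\<lambda>_. g"] by simp_all
    with g(2) show "E \<in> Z \<Omega> X"
      unfolding Z_def Zn_def by blast
  qed
qed

end

theory Submission
  imports Defs "Jordan_Normal_Form.Determinant"
begin

text \<open>
  \<^emph>\<open>From depth \<open>n\<close> to zero sets.\<close> The deep zeros of a family are the zeros of its Wronskian:
  a combination has an \<open>n\<close>-deep zero at \<open>z\<close> iff its derivatives of order \<open>0, \<dots>, n\<close> vanish at
  \<open>z\<close>, so a nontrivial one exists iff the matrix of these derivatives has a kernel
  (\<open>deep_zero_set_eq_wronskian_zeros\<close>). The Wronskian is a polynomial in derivatives of members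
  of \<open>X\<close>, hence lies in \<open>X\<close> (\<open>wronskian_closed\<close>). That it is not the null function, i.e. that
  some point of the domain is not a deep zero, is the content of \<open>exists_not_deep_zero\<close>. Its
  induction needs no determinants: dividing by a zero-free \<open>f 0\<close> does not change the depth
  of a zero, and differentiating then removes the first function and lowers the depth by one.

  \<^emph>\<open>From zero sets to depth \<open>n\<close>.\<close> The same reduction run backwards raises the depth one step at
  a time (\<open>Zn_subset_Zn_Suc\<close>): adjoin the constant \<open>1\<close> to primitives, in \<open>X\<close>, of the given
  functions. A combination of the new family has an \<open>(n + 1)\<close>-deep zero iff it vanishes there
  and its derivative, a combination of the old family, has an \<open>n\<close>-deep zero; the coefficient of
  \<open>1\<close> is free and makes it vanish.
\<close>

section \<open>Deep zeros and derivatives\<close>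

lemma deep_zero_cong:
  assumes "open S" "z \<in> S" "\<And>w. w \<in> S \<Longrightarrow> f w = g w"
  shows "deep_zero n f z \<longleftrightarrow> deep_zero n g z"
proof -
  have ev: "\<forall>\<^sub>F w in nhds z. f w = g w"
    using eventually_nhds_in_open[OF assms(1,2)] assms(3) by (auto elim: eventually_mono)
  have "f z = g z"
    using assms by blast
  moreover have "zorder f z = zorder g z"
    using ev by (intro zorder_cong) (auto simp: eventually_at_filter elim: eventually_mono)
  moreover have "(\<forall>\<^sub>F w in nhds z. f w = 0) \<longleftrightarrow> (\<forall>\<^sub>F w in nhds z. g w = 0)"
    using ev by (intro eventually_cong) (auto elim: eventually_mono)
  ultimately show ?thesis
    by (simp add: deep_zero_def)
qed

lemma eventually_zero_iff_deriv:
  assumes "open S" "h holomorphic_on S" "z \<in> S"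
  shows "(\<forall>\<^sub>F w in nhds z. h w = 0) \<longleftrightarrow> h z = 0 \<and> (\<forall>\<^sub>F w in nhds z. deriv h w = 0)"
proof (intro iffI conjI)
  assume h: "\<forall>\<^sub>F w in nhds z. h w = 0"
  then show "h z = 0"
    using eventually_nhds_x_imp_x by blast
  from h have "\<forall>\<^sub>F w in nhds z. \<forall>\<^sub>F v in nhds w. h v = 0"
    by (simp add: eventually_eventually)
  then show "\<forall>\<^sub>F w in nhds z. deriv h w = 0"
  proof (rule eventually_mono)
    fix w assume "\<forall>\<^sub>F v in nhds w. h v = 0"
    then have "deriv h w = deriv (\<lambda>_. 0) w"
      by (intro deriv_cong_ev) auto
    then show "deriv h w = 0" by simp
  qed
next
  assume h: "h z = 0 \<and> (\<forall>\<^sub>F w in nhds z. deriv h w = 0)"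
  then have "\<forall>\<^sub>F w in nhds z. deriv h w = 0 \<and> w \<in> S"
    using eventually_nhds_in_open[OF assms(1,3)] by (simp add: eventually_conj_iff)
  then obtain e where e: "e > 0" "\<And>w. w \<in> ball z e \<Longrightarrow> deriv h w = 0 \<and> w \<in> S"
    by (auto simp: eventually_nhds_metric dist_commute)
  have "(h has_field_derivative 0) (at w within ball z e)" if "w \<in> ball z e" for w
    using holomorphic_derivI[OF assms(2,1), of w] e(2)[OF that]
    by (metis has_field_derivative_at_within)
  then obtain k where "\<forall>w\<in>ball z e. h w = k"
    using has_field_derivative_zero_constant[of "ball z e" h] by auto
  then have "\<forall>w\<in>ball z e. h w = 0"
    using h e(1) by (metis centre_in_ball)
  then show "\<forall>\<^sub>F w in nhds z. h w = 0"
    using e(1) by (auto simp: eventually_nhds_metric dist_commute)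
qed

text \<open>
  The engine of both inclusions. For a function that is not locally null, differentiation at a
  zero lowers \<open>zorder\<close> by exactly one; the locally null case has to be split off because
  \<open>zorder\<close> says nothing there.
\<close>

lemma deep_zero_Suc_iff:
  assumes "open S" "h holomorphic_on S" "z \<in> S"
  shows "deep_zero (Suc n) h z \<longleftrightarrow> h z = 0 \<and> deep_zero n (deriv h) z"
proof (cases "h z = 0 \<and> \<not> (\<forall>\<^sub>F w in nhds z. h w = 0)")
  case True
  then have h0: "h z = 0" and nz: "\<exists>\<^sub>F w in at z. h w \<noteq> 0"
    by (auto simp: frequently_def eventually_nhds_conv_at)
  have dnz: "\<not> (\<forall>\<^sub>F w in nhds z. deriv h w = 0)"
    using True eventually_zero_iff_deriv[OF assms] by blast
  have an: "h analytic_on {z}"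
    using assms analytic_at by blast
  have dh: "deriv h holomorphic_on S"
    using assms by (intro holomorphic_deriv)
  have pos: "zorder h z > 0"
    using zorder_pos_iff[OF assms(2,1,3) nz] h0 by simp
  have ord: "zorder (deriv h) z = zorder h z - 1"
    using zorder_deriv_minus_1[of h z] an nz pos
    by (simp add: isolated_singularity_at_analytic not_essential_analytic)
  have "deriv h z = 0" if "zorder (deriv h) z \<ge> int (n + 1)"
  proof (rule ccontr)
    assume d: "deriv h z \<noteq> 0"
    have "deriv h analytic_on {z}"
      using dh assms(1,3) analytic_at by blast
    then have "\<forall>\<^sub>F w in at z. deriv h w \<noteq> 0"
      using d by (rule analytic_at_neq_imp_eventually_neq)
    then have "\<exists>\<^sub>F w in at z. deriv h w \<noteq> 0"
      by (intro eventually_frequently) auto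
    then show False
      using zorder_pos_iff[OF dh assms(1,3)] d that by simp
  qed
  then show ?thesis
    using h0 dnz True ord by (auto simp: deep_zero_def)
next
  case False
  then show ?thesis
    using eventually_zero_iff_deriv[OF assms] by (auto simp: deep_zero_def)
qed

lemma deep_zero_iff_higher_deriv:
  assumes "open S" "h holomorphic_on S" "z \<in> S"
  shows "deep_zero n h z \<longleftrightarrow> (\<forall>k\<le>n. (deriv ^^ k) h z = 0)"
  using assms(2)
proof (induction n arbitrary: h)
  case 0
  then show ?case using assms by (simp add: deep_zero_0_iff)
next
  case (Suc n)
  have "deep_zero (Suc n) h z \<longleftrightarrow> h z = 0 \<and> (\<forall>k\<le>n. (deriv ^^ k) (deriv h) z = 0)"
    using Suc assms by (simp add: deep_zero_Suc_iff holomorphic_deriv)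
  also have "\<dots> \<longleftrightarrow> (\<forall>k\<le>Suc n. (deriv ^^ k) h z = 0)"
    by (simp only: less_Suc_eq_le[symmetric] All_less_Suc2 funpow_Suc_right funpow_0 comp_apply)
  finally show ?case .
qed

text \<open>
  By the Leibniz rule. For the zero-free factor \<open>1 / f 0\<close> this lets the depth survive the division
  in \<open>exists_not_deep_zero\<close>.
\<close>

lemma deep_zero_mult:
  assumes "open S" "z \<in> S" "h holomorphic_on S" "u holomorphic_on S" "deep_zero n h z"
  shows "deep_zero n (\<lambda>w. h w * u w) z"
proof -
  have "(\<lambda>w. h w * u w) holomorphic_on S"
    using assms by (intro holomorphic_intros)
  moreover have "(deriv ^^ i) h z = 0" if "i \<le> n" for i
    using assms that deep_zero_iff_higher_deriv by blast
  then have "(deriv ^^ k) (\<lambda>w. h w * u w) z = 0" if "k \<le> n" for k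
    using that assms by (simp add: higher_deriv_mult)
  ultimately show ?thesis
    using assms(1,2) by (simp add: deep_zero_iff_higher_deriv)
qed

lemma higher_deriv_lincomb:
  fixes m :: nat
  assumes "open S" "z \<in> S" "\<And>j. j \<le> m \<Longrightarrow> f j holomorphic_on S"
  shows "(deriv ^^ i) (\<lambda>w. \<Sum>j\<le>m. c j * f j w) z = (\<Sum>j\<le>m. c j * (deriv ^^ i) (f j) z)"
  using assms(3)
proof (induction m)
  case 0
  then show ?case using assms(1,2) by (simp add: higher_deriv_cmult[of _ S])
next
  case (Suc m)
  have "(deriv ^^ i) (\<lambda>w. (\<Sum>j\<le>m. c j * f j w) + c (Suc m) * f (Suc m) w) z
      = (deriv ^^ i) (\<lambda>w. \<Sum>j\<le>m. c j * f j w) z + (deriv ^^ i) (\<lambda>w. c (Suc m) * f (Suc m) w) z"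
    using Suc.prems assms by (intro higher_deriv_add[of _ S] holomorphic_intros) auto
  then show ?case
    using Suc assms(1,2) by (simp add: higher_deriv_cmult[of _ S])
qed

lemma deriv_lincomb:
  fixes m :: nat
  assumes "open S" "z \<in> S" "\<And>j. j \<le> m \<Longrightarrow> f j holomorphic_on S"
  shows "deriv (\<lambda>w. \<Sum>j\<le>m. c j * f j w) z = (\<Sum>j\<le>m. c j * deriv (f j) z)"
  using higher_deriv_lincomb[OF assms, where i = 1 and c = c] by simp

section \<open>The generic point is not a deep zero\<close>

text \<open>
  This is the nonvanishing of the Wronskian of a linearly independent family, read through deep
  zeros. On a disc \<open>B\<close> on which \<open>f 0\<close> has no zeros, the \<open>n + 1\<close> functions
  \<open>(f j / f 0)'\<close> with \<open>j \<ge> 1\<close> are again linearly independent: a relation between them integrates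
  to one between the \<open>f j\<close>, which spreads from \<open>B\<close> to \<open>U\<close> by the identity theorem. A deep zero in
  \<open>B\<close> of the original family is a deep zero, one level lower, of the derived one, so the induction
  hypothesis yields a point that is neither.
\<close>

lemma exists_not_deep_zero:
  assumes "open U" "connected U" "U \<noteq> {}"
    and "\<And>j. j \<le> n \<Longrightarrow> f j holomorphic_on U" and "lin_indep U n f"
  shows "\<exists>z\<in>U. z \<notin> deep_zero_set U n f"
  using assms
proof (induction n arbitrary: U f)
  case 0
  obtain z where z: "z \<in> U" "f 0 z \<noteq> 0"
    using iffD1[OF lin_indep_def 0(5), THEN spec, of "\<lambda>_. 1"] by auto
  have "\<not> deep_zero 0 (\<lambda>w. c * f 0 w) z" if "c \<noteq> 0" for c
  proof -
    have "(\<lambda>w. c * f 0 w) holomorphic_on U"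
      using 0(4)[of 0] by (intro holomorphic_intros) auto
    then show ?thesis
      using deep_zero_0_iff[OF 0(1) _ z(1)] z(2) that by auto
  qed
  then show ?case
    using z by (auto simp: deep_zero_set_def)
next
  case (Suc n)
  obtain z0 where z0: "z0 \<in> U" "f 0 z0 \<noteq> 0"
    using iffD1[OF lin_indep_def Suc.prems(5), THEN spec, of "\<lambda>j. if j = 0 then 1 else 0"]
    by (auto simp: sum.atMost_Suc_shift simp del: sum.atMost_Suc)
  have f0: "f 0 holomorphic_on U" using Suc.prems by simp
  have "open (U \<inter> f 0 -` (- {0}))"
    using Suc.prems(1) f0 by (intro continuous_open_preimage holomorphic_on_imp_continuous_on) auto
  then obtain e where e: "e > 0" "ball z0 e \<subseteq> U \<inter> f 0 -` (- {0})"
    using z0 by (metis (no_types, lifting) ComplI IntI openE singletonD vimageI)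
  define B where "B = ball z0 e"
  have B: "open B" "connected B" "B \<noteq> {}" "z0 \<in> B" "B \<subseteq> U" "\<And>w. w \<in> B \<Longrightarrow> f 0 w \<noteq> 0"
    using e by (auto simp: B_def)
  have fB: "f j holomorphic_on B" if "j \<le> Suc n" for j
    using Suc.prems(4)[OF that] B(5) holomorphic_on_subset by blast
  define q where "q j w = f (Suc j) w / f 0 w" for j w
  define g where "g j = deriv (q j)" for j
  have q: "q j holomorphic_on B" if "j \<le> n" for j
    unfolding q_def using fB that B(6) by (intro holomorphic_intros) auto
  have g: "g j holomorphic_on B" if "j \<le> n" for j
    unfolding g_def using q[OF that] B(1) by (intro holomorphic_deriv)
  have split: "(\<Sum>j\<le>Suc n. c j * f j w) = f 0 w * (c 0 + (\<Sum>j\<le>n. c (Suc j) * q j w))"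
    if "w \<in> B" for c w
    using B(6)[OF that]
    by (simp add: sum.atMost_Suc_shift q_def sum_distrib_left algebra_simps del: sum.atMost_Suc)
  have "lin_indep B n g"
    unfolding lin_indep_def
  proof (intro allI impI)
    fix d :: "nat \<Rightarrow> complex" and j
    assume d: "\<forall>z\<in>B. (\<Sum>j\<le>n. d j * g j z) = 0" and j: "j \<le> n"
    let ?h = "\<lambda>w. \<Sum>j\<le>n. d j * q j w"
    have hol: "?h holomorphic_on B"
      using q by (intro holomorphic_intros) auto
    have "(?h has_field_derivative 0) (at w within B)" if "w \<in> B" for w
      using holomorphic_derivI[OF hol B(1) that] d that deriv_lincomb[OF B(1) that q, where c = d]
      by (auto simp: g_def intro: has_field_derivative_at_within)
    then obtain k where k: "\<And>w. w \<in> B \<Longrightarrow> ?h w = k"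
      using has_field_derivative_zero_constant[of B ?h] by (auto simp: B_def)
    \<comment> \<open>the constant of integration becomes the coefficient of \<open>f 0\<close>\<close>
    define c where "c = case_nat (- k) d"
    let ?F = "\<lambda>w. \<Sum>j\<le>Suc n. c j * f j w"
    have "?F w = 0" if "w \<in> B" for w
      unfolding split[OF that] using k[OF that] by (simp add: c_def)
    then have "\<forall>\<^sub>F w in nhds z0. ?F w = 0"
      using eventually_nhds_in_open[OF B(1,4)] by (auto elim: eventually_mono)
    then have "(deriv ^^ i) ?F z0 = (deriv ^^ i) (\<lambda>_. 0) z0" for i
      by (intro higher_deriv_cong_ev) auto
    then have der: "(deriv ^^ i) ?F z0 = 0" for i
      by simp
    have "?F holomorphic_on U"
      using Suc.prems(4) by (intro holomorphic_intros) auto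
    then have "\<forall>w\<in>U. ?F w = 0"
      using holomorphic_fun_eq_0_on_connected[of ?F U z0] Suc.prems(1,2) der z0(1) by blast
    then have "c (Suc j) = 0"
      using Suc.prems(5) j unfolding lin_indep_def by (meson Suc_le_mono)
    then show "d j = 0" by (simp add: c_def)
  qed
  then obtain z where z: "z \<in> B" "z \<notin> deep_zero_set B n g"
    using Suc.IH[of B g] B g by blast
  have False if c: "\<exists>j\<le>Suc n. c j \<noteq> 0" "deep_zero (Suc n) (\<lambda>w. \<Sum>j\<le>Suc n. c j * f j w) z" for c
  proof -
    let ?F = "\<lambda>w. \<Sum>j\<le>Suc n. c j * f j w"
    let ?G = "\<lambda>w. ?F w * (1 / f 0 w)"
    let ?h = "\<lambda>w. \<Sum>j\<le>n. c (Suc j) * q j w"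
    have hF: "?F holomorphic_on B" using fB by (intro holomorphic_intros) auto
    have hu: "(\<lambda>w. 1 / f 0 w) holomorphic_on B" using fB B(6) by (intro holomorphic_intros) auto
    have hol: "?h holomorphic_on B"
      using q by (intro holomorphic_intros) auto
    have hol': "(\<lambda>w. c 0 + ?h w) holomorphic_on B"
      by (intro holomorphic_on_add holomorphic_on_const hol)
    have G: "?G w = c 0 + ?h w" if "w \<in> B" for w
      unfolding split[OF that] using B(6)[OF that] by simp
    have "deep_zero (Suc n) ?G z"
      using deep_zero_mult[OF B(1) z(1) hF hu c(2)] .
    then have "deep_zero (Suc n) (\<lambda>w. c 0 + ?h w) z"
      using deep_zero_cong[OF B(1) z(1), of ?G "\<lambda>w. c 0 + ?h w"] G by blast
    then have "deep_zero n (deriv (\<lambda>w. c 0 + ?h w)) z"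
      using deep_zero_Suc_iff[OF B(1) hol' z(1)] by blast
    moreover have "deriv (\<lambda>w. c 0 + ?h w) w = (\<Sum>j\<le>n. c (Suc j) * g j w)" if "w \<in> B" for w
    proof -
      have "((\<lambda>w. c 0 + ?h w) has_field_derivative 0 + deriv ?h w) (at w)"
        using holomorphic_derivI[OF hol B(1) that] by (intro derivative_intros) auto
      then show ?thesis
        using deriv_lincomb[OF B(1) that q, where c = "\<lambda>j. c (Suc j)"] DERIV_imp_deriv
        by (simp add: g_def)
    qed
    ultimately have deep: "deep_zero n (\<lambda>w. \<Sum>j\<le>n. c (Suc j) * g j w) z"
      using deep_zero_cong[OF B(1) z(1), of "deriv (\<lambda>w. c 0 + ?h w)"
          "\<lambda>w. \<Sum>j\<le>n. c (Suc j) * g j w"] by blast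
    have 0: "c (Suc j) = 0" if "j \<le> n" for j
    proof (rule ccontr)
      assume "c (Suc j) \<noteq> 0"
      with that deep have "z \<in> deep_zero_set B n g"
        unfolding deep_zero_set_def
        by (intro CollectI conjI exI[of _ "\<lambda>j. c (Suc j)"] exI[of _ j] z(1))
      with z(2) show False by contradiction
    qed
    \<comment> \<open>only \<open>c 0\<close> is left, and \<open>f 0\<close> does not vanish at \<open>z\<close>\<close>
    have "?F z = 0"
      using c(2) deep_zero_Suc_iff[OF B(1) hF z(1)] by blast
    then have "c 0 = 0"
      unfolding split[OF z(1)] using 0 B(6)[OF z(1)] by simp
    then have "c j = 0" if "j \<le> Suc n" for j
      using 0 that by (cases j) auto
    with c(1) show False by blast
  qed
  then have "z \<notin> deep_zero_set U (Suc n) f"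
    unfolding deep_zero_set_def by blast
  then show ?case
    using z(1) B(5) by blast
qed

section \<open>Membership in a differential algebra\<close>

lemma algebra_sum:
  assumes "is_algebra \<Omega> X" "finite I" "\<And>i. i \<in> I \<Longrightarrow> restrict (F i) \<Omega> \<in> X"
  shows "restrict (\<lambda>z. \<Sum>i\<in>I. F i z) \<Omega> \<in> X"
  using assms(2,3)
proof (induction I rule: finite_induct)
  case empty
  then show ?case using assms(1) unfolding is_algebra_def sum.empty by blast
next
  case (insert i I)
  then have "(\<lambda>z\<in>\<Omega>. restrict (F i) \<Omega> z + restrict (\<lambda>z. \<Sum>i\<in>I. F i z) \<Omega> z) \<in> X"
    using assms(1) unfolding is_algebra_def by blast
  also have "(\<lambda>z\<in>\<Omega>. restrict (F i) \<Omega> z + restrict (\<lambda>z. \<Sum>i\<in>I. F i z) \<Omega> z)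
      = restrict (\<lambda>z. \<Sum>i\<in>insert i I. F i z) \<Omega>"
    using insert by (intro restrict_ext) simp
  finally show ?case .
qed

lemma algebra_prod:
  assumes "is_algebra \<Omega> X" "(\<lambda>z\<in>\<Omega>. 1) \<in> X" "finite I" "\<And>i. i \<in> I \<Longrightarrow> restrict (F i) \<Omega> \<in> X"
  shows "restrict (\<lambda>z. \<Prod>i\<in>I. F i z) \<Omega> \<in> X"
  using assms(3,4)
proof (induction I rule: finite_induct)
  case empty
  show ?case using assms(2) unfolding prod.empty .
next
  case (insert i I)
  then have "(\<lambda>z\<in>\<Omega>. restrict (F i) \<Omega> z * restrict (\<lambda>z. \<Prod>i\<in>I. F i z) \<Omega> z) \<in> X"
    using assms(1) unfolding is_algebra_def by blast
  also have "(\<lambda>z\<in>\<Omega>. restrict (F i) \<Omega> z * restrict (\<lambda>z. \<Prod>i\<in>I. F i z) \<Omega> z)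
      = restrict (\<lambda>z. \<Prod>i\<in>insert i I. F i z) \<Omega>"
    using insert by (intro restrict_ext) simp
  finally show ?case .
qed

lemma algebra_cmult:
  assumes "is_algebra \<Omega> X" "restrict F \<Omega> \<in> X"
  shows "restrict (\<lambda>z. c * F z) \<Omega> \<in> X"
proof -
  have "(\<lambda>z\<in>\<Omega>. c * restrict F \<Omega> z) \<in> X"
    using assms unfolding is_algebra_def by blast
  also have "(\<lambda>z\<in>\<Omega>. c * restrict F \<Omega> z) = restrict (\<lambda>z. c * F z) \<Omega>"
    by (intro restrict_ext) simp
  finally show ?thesis .
qed

text \<open>
  The members of \<open>deriv_set\<close> are undefined off \<open>\<Omega>\<close>, so iterating the closure property alternates
  \<open>deriv\<close> with \<open>restrict\<close>; since \<open>\<Omega>\<close> is open, restricting only at the end gives the same function.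
\<close>

lemma higher_deriv_closed:
  assumes "open \<Omega>" "X \<subseteq> Hol \<Omega>" "deriv_set \<Omega> X \<subseteq> X" "f \<in> X"
  shows "restrict ((deriv ^^ i) f) \<Omega> \<in> X"
proof (induction i)
  case 0
  have "f \<in> extensional \<Omega>" using assms by (auto simp: Hol_def)
  then show ?case using assms(4) by (simp add: extensional_restrict)
next
  case (Suc i)
  have "restrict (deriv (restrict ((deriv ^^ i) f) \<Omega>)) \<Omega> \<in> X"
    using Suc assms(3) unfolding deriv_set_def by blast
  also have "restrict (deriv (restrict ((deriv ^^ i) f) \<Omega>)) \<Omega> = restrict ((deriv ^^ Suc i) f) \<Omega>"
  proof (rule restrict_ext)
    fix z assume "z \<in> \<Omega>"
    from eventually_nhds_in_open[OF assms(1) this]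
    have "\<forall>\<^sub>F w in nhds z. restrict ((deriv ^^ i) f) \<Omega> w = (deriv ^^ i) f w"
      by (rule eventually_mono) simp
    then show "deriv (restrict ((deriv ^^ i) f) \<Omega>) z = (deriv ^^ Suc i) f z"
      by (simp add: deriv_cong_ev)
  qed
  finally show ?case .
qed

section \<open>The Wronskian\<close>

definition wronskian :: "nat \<Rightarrow> (nat \<Rightarrow> complex \<Rightarrow> complex) \<Rightarrow> complex \<Rightarrow> complex" where
  "wronskian n f z = det (mat (Suc n) (Suc n) (\<lambda>(i, j). (deriv ^^ i) (f j) z))"

lemma det_mat_eq_0_iff:
  fixes a :: "nat \<Rightarrow> nat \<Rightarrow> 'a :: field"
  shows "det (mat (Suc n) (Suc n) (\<lambda>(i, j). a i j)) = 0 \<longleftrightarrow>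
    (\<exists>c. (\<exists>j\<le>n. c j \<noteq> 0) \<and> (\<forall>i\<le>n. (\<Sum>j\<le>n. c j * a i j) = 0))" (is "det ?A = 0 \<longleftrightarrow> ?R")
proof -
  have ker: "?A *\<^sub>v v = 0\<^sub>v (Suc n) \<longleftrightarrow> (\<forall>i\<le>n. (\<Sum>j\<le>n. vec_index v j * a i j) = 0)"
    if "v \<in> carrier_vec (Suc n)" for v
    using that
    by (auto simp: Matrix.vec_eq_iff scalar_prod_def less_Suc_eq_le atLeast0LessThan lessThan_Suc_atMost mult.commute)
  have nz: "v \<noteq> 0\<^sub>v (Suc n) \<longleftrightarrow> (\<exists>j\<le>n. vec_index v j \<noteq> 0)"
    if "v \<in> carrier_vec (Suc n)" for v :: "'a Matrix.vec"
    using that by (auto simp: Matrix.vec_eq_iff less_Suc_eq_le)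
  have "det ?A = 0 \<longleftrightarrow> (\<exists>v. v \<in> carrier_vec (Suc n) \<and> v \<noteq> 0\<^sub>v (Suc n) \<and> ?A *\<^sub>v v = 0\<^sub>v (Suc n))"
    by (rule det_0_iff_vec_prod_zero_field) simp
  also have "\<dots> \<longleftrightarrow> ?R"
  proof
    assume "\<exists>v. v \<in> carrier_vec (Suc n) \<and> v \<noteq> 0\<^sub>v (Suc n) \<and> ?A *\<^sub>v v = 0\<^sub>v (Suc n)"
    then show ?R using ker nz by blast
  next
    assume ?R
    then obtain c where c: "\<exists>j\<le>n. c j \<noteq> 0" "\<forall>i\<le>n. (\<Sum>j\<le>n. c j * a i j) = 0" by blast
    let ?v = "Matrix.vec (Suc n) c"
    have v: "?v \<in> carrier_vec (Suc n)" by simp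
    have eq: "vec_index ?v j = c j" if "j \<le> n" for j
      using that by simp
    have "?v \<noteq> 0\<^sub>v (Suc n)"
      unfolding nz[OF v] using c(1) eq by metis
    moreover have "?A *\<^sub>v ?v = 0\<^sub>v (Suc n)"
      unfolding ker[OF v] using c(2) eq by simp
    ultimately show "\<exists>v. v \<in> carrier_vec (Suc n) \<and> v \<noteq> 0\<^sub>v (Suc n) \<and> ?A *\<^sub>v v = 0\<^sub>v (Suc n)"
      using v by blast
  qed
  finally show ?thesis .
qed

lemma deep_zero_set_eq_wronskian_zeros:
  assumes "open \<Omega>" "\<And>j. j \<le> n \<Longrightarrow> f j holomorphic_on \<Omega>"
  shows "deep_zero_set \<Omega> n f = {z \<in> \<Omega>. wronskian n f z = 0}"
proof -
  have "deep_zero n (\<lambda>w. \<Sum>j\<le>n. c j * f j w) z \<longleftrightarrow>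
      (\<forall>i\<le>n. (\<Sum>j\<le>n. c j * (deriv ^^ i) (f j) z) = 0)" if "z \<in> \<Omega>" for c z
  proof -
    have "(\<lambda>w. \<Sum>j\<le>n. c j * f j w) holomorphic_on \<Omega>"
      using assms(2) by (intro holomorphic_intros) auto
    then show ?thesis
      using deep_zero_iff_higher_deriv[OF assms(1) _ that] higher_deriv_lincomb[OF assms(1) that assms(2)]
      by simp
  qed
  then show ?thesis
    unfolding deep_zero_set_def wronskian_def det_mat_eq_0_iff by blast
qed

text \<open>The Leibniz expansion of the determinant exhibits the Wronskian as a sum of products.\<close>

lemma wronskian_closed:
  assumes "open \<Omega>" "is_algebra \<Omega> X" "(\<lambda>z\<in>\<Omega>. 1) \<in> X" "deriv_set \<Omega> X \<subseteq> X"
    and "\<And>j. j \<le> n \<Longrightarrow> f j \<in> X"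
  shows "restrict (wronskian n f) \<Omega> \<in> X"
proof -
  have XH: "X \<subseteq> Hol \<Omega>" using assms(2) by (simp add: is_algebra_def)
  let ?P = "{p. p permutes {0..<Suc n}}"
  have "wronskian n f z = (\<Sum>p\<in>?P. signof p * (\<Prod>i = 0..<Suc n. (deriv ^^ i) (f (p i)) z))" for z
    unfolding wronskian_def det_def
    by (auto intro!: sum.cong prod.cong simp: permutes_in_image simp del: prod.op_ivl_Suc sum.op_ivl_Suc)
  then have "wronskian n f = (\<lambda>z. \<Sum>p\<in>?P. signof p * (\<Prod>i = 0..<Suc n. (deriv ^^ i) (f (p i)) z))"
    by blast
  moreover have "restrict (\<lambda>z. \<Sum>p\<in>?P. signof p * (\<Prod>i = 0..<Suc n. (deriv ^^ i) (f (p i)) z)) \<Omega> \<in> X"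
  proof (intro algebra_sum[OF assms(2)] algebra_cmult[OF assms(2)] algebra_prod[OF assms(2,3)]
      higher_deriv_closed[OF assms(1) XH assms(4)])
    fix p i assume "p \<in> ?P" "i \<in> {0..<Suc n}"
    then have "p i \<in> {0..<Suc n}" by (simp add: permutes_in_image del: atLeastLessThan_iff)
    then show "f (p i) \<in> X" using assms(5) by simp
  qed (auto intro: finite_permutations)
  ultimately show ?thesis by simp
qed

lemma Zn_subset_Z:
  assumes "domain_set \<Omega>" "is_algebra \<Omega> X" "(\<lambda>z\<in>\<Omega>. 1) \<in> X" "deriv_set \<Omega> X \<subseteq> X"
  shows "Zn \<Omega> n X \<subseteq> Z \<Omega> X"
proof
  fix E assume "E \<in> Zn \<Omega> n X"
  then obtain f where f: "E = deep_zero_set \<Omega> n f" "\<And>j. j \<le> n \<Longrightarrow> f j \<in> X" "lin_indep \<Omega> n f"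
    by (auto simp: Zn_def)
  have dom: "open \<Omega>" "connected \<Omega>" "\<Omega> \<noteq> {}" using assms(1) by (auto simp: domain_set_def)
  have XH: "X \<subseteq> Hol \<Omega>" using assms(2) by (simp add: is_algebra_def)
  then have hol: "f j holomorphic_on \<Omega>" if "j \<le> n" for j
    using f(2)[OF that] by (auto simp: Hol_def)
  have E: "E = {z \<in> \<Omega>. wronskian n f z = 0}"
    using f(1) deep_zero_set_eq_wronskian_zeros[OF dom(1) hol] by simp
  obtain z where "z \<in> \<Omega>" "z \<notin> E"
    using exists_not_deep_zero[OF dom hol f(3)] f(1) by blast
  then have "E = {z \<in> \<Omega>. restrict (wronskian n f) \<Omega> z = 0}"
    "\<exists>z\<in>\<Omega>. restrict (wronskian n f) \<Omega> z \<noteq> 0"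
    using E by auto
  then show "E \<in> Z \<Omega> X"
    unfolding Z_eq_zero_sets[OF dom(1) XH]
    by (intro CollectI exI[of _ "restrict (wronskian n f) \<Omega>"] conjI
        wronskian_closed[OF dom(1) assms(2-4) f(2)])
qed

section \<open>Raising the depth by taking primitives\<close>

text \<open>
  For a combination \<open>H\<close> of \<open>1\<close> and the primitives \<open>F j\<close>, the derivative \<open>H'\<close> involves all
  coefficients but that of \<open>1\<close>. If these vanish, \<open>H\<close> is constant and a single zero makes it null
  (step \<open>zero\<close>); this settles both the linear independence of the new family and the
  nontriviality of the combination of the \<open>f j\<close> obtained by differentiating.
\<close>

lemma Zn_subset_Zn_Suc:
  assumes "open \<Omega>" "\<Omega> \<noteq> {}" "X \<subseteq> Hol \<Omega>" "(\<lambda>z\<in>\<Omega>. 1) \<in> X" "X \<subseteq> deriv_set \<Omega> X"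
  shows "Zn \<Omega> n X \<subseteq> Zn \<Omega> (Suc n) X"
proof
  fix E assume "E \<in> Zn \<Omega> n X"
  then obtain f where f: "E = deep_zero_set \<Omega> n f" "\<And>j. j \<le> n \<Longrightarrow> f j \<in> X" "lin_indep \<Omega> n f"
    by (auto simp: Zn_def)
  have "\<forall>j. \<exists>F. j \<le> n \<longrightarrow> F \<in> X \<and> f j = restrict (deriv F) \<Omega>"
    using f(2) assms(5) by (auto simp: deriv_set_def)
  then obtain F where F: "\<And>j. j \<le> n \<Longrightarrow> F j \<in> X" "\<And>j. j \<le> n \<Longrightarrow> f j = restrict (deriv (F j)) \<Omega>"
    by metis
  have holF: "F j holomorphic_on \<Omega>" if "j \<le> n" for j
    using F(1)[OF that] assms(3) by (auto simp: Hol_def)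
  define G where "G = case_nat (\<lambda>z\<in>\<Omega>. 1) F"
  have G: "G j \<in> X" if "j \<le> Suc n" for j
    using that F(1) assms(4) by (auto simp: G_def split: nat.split)
  let ?H = "\<lambda>c w. \<Sum>j\<le>Suc n. c j * G j w"
  have H: "?H c w = c 0 + (\<Sum>j\<le>n. c (Suc j) * F j w)" if "w \<in> \<Omega>" for c w
    using that by (simp add: sum.atMost_Suc_shift G_def del: sum.atMost_Suc)
  have hol: "?H c holomorphic_on \<Omega>" for c
    using G assms(3) by (intro holomorphic_intros) (auto simp: Hol_def)
  have dH: "deriv (?H c) z = (\<Sum>j\<le>n. c (Suc j) * f j z)" if "z \<in> \<Omega>" for c z
  proof -
    let ?h = "\<lambda>w. \<Sum>j\<le>n. c (Suc j) * F j w"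
    have "?h holomorphic_on \<Omega>" using holF by (intro holomorphic_intros) auto
    then have "((\<lambda>w. c 0 + ?h w) has_field_derivative 0 + deriv ?h z) (at z)"
      using holomorphic_derivI[OF _ assms(1) that] by (intro derivative_intros) auto
    moreover have "deriv (?H c) z = deriv (\<lambda>w. c 0 + ?h w) z"
      using H eventually_nhds_in_open[OF assms(1) that]
      by (intro deriv_cong_ev) (auto elim!: eventually_mono)
    ultimately have "deriv (?H c) z = deriv ?h z"
      using DERIV_imp_deriv by fastforce
    also have "\<dots> = (\<Sum>j\<le>n. c (Suc j) * f j z)"
      using deriv_lincomb[OF assms(1) that holF, where c = "\<lambda>j. c (Suc j)"] F(2) that by simp
    finally show ?thesis .
  qed
  have deep: "deep_zero (Suc n) (?H c) z \<longleftrightarrow>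
      ?H c z = 0 \<and> deep_zero n (\<lambda>w. \<Sum>j\<le>n. c (Suc j) * f j w) z" if "z \<in> \<Omega>" for c z
  proof -
    have "deep_zero n (deriv (?H c)) z \<longleftrightarrow> deep_zero n (\<lambda>w. \<Sum>j\<le>n. c (Suc j) * f j w) z"
      using dH by (intro deep_zero_cong[OF assms(1) that])
    then show ?thesis
      using deep_zero_Suc_iff[OF assms(1) hol that] by simp
  qed
  have zero: "c j = 0" if "\<forall>j\<le>n. c (Suc j) = 0" "z \<in> \<Omega>" "?H c z = 0" "j \<le> Suc n"
    for c :: "nat \<Rightarrow> complex" and j z
    using that H[OF that(2), of c] by (cases j) auto
  have "lin_indep \<Omega> (Suc n) G"
    unfolding lin_indep_def
  proof (rule allI, rule impI)
    fix c assume c: "\<forall>z\<in>\<Omega>. ?H c z = 0"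
    have "(\<Sum>j\<le>n. c (Suc j) * f j z) = 0" if "z \<in> \<Omega>" for z
    proof -
      have "deriv (?H c) z = deriv (\<lambda>_. 0) z"
        using c eventually_nhds_in_open[OF assms(1) that]
        by (intro deriv_cong_ev) (auto elim!: eventually_mono)
      then show ?thesis using dH[OF that] by simp
    qed
    then have "\<forall>j\<le>n. c (Suc j) = 0"
      using f(3)[unfolded lin_indep_def, THEN spec, of "\<lambda>j. c (Suc j)"] by blast
    then show "\<forall>j\<le>Suc n. c j = 0"
      using zero c assms(2) by blast
  qed
  moreover have "deep_zero_set \<Omega> (Suc n) G = E"
  proof (intro equalityI subsetI)
    fix z assume "z \<in> deep_zero_set \<Omega> (Suc n) G"
    then obtain c where z: "z \<in> \<Omega>" and c: "\<exists>j\<le>Suc n. c j \<noteq> 0" "deep_zero (Suc n) (?H c) z"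
      unfolding deep_zero_set_def by blast
    have Hz: "?H c z = 0" and fz: "deep_zero n (\<lambda>w. \<Sum>j\<le>n. c (Suc j) * f j w) z"
      using deep[OF z] c(2) by blast+
    have "\<exists>j\<le>n. c (Suc j) \<noteq> 0"
      using zero[of c z] z c(1) Hz by blast
    with fz z show "z \<in> E"
      unfolding f(1) deep_zero_set_def
      by (intro CollectI conjI exI[of _ "\<lambda>j. c (Suc j)"])
  next
    fix z assume "z \<in> E"
    then obtain d j where z: "z \<in> \<Omega>" and d: "j \<le> n" "d j \<noteq> 0"
      "deep_zero n (\<lambda>w. \<Sum>j\<le>n. d j * f j w) z"
      unfolding f(1) deep_zero_set_def by blast
    \<comment> \<open>the constant is chosen to make the integrated combination vanish at \<open>z\<close>\<close>
    define c where "c = case_nat (- (\<Sum>j\<le>n. d j * F j z)) d"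
    have cS: "c (Suc j) = d j" for j
      by (simp add: c_def)
    have "?H c z = 0"
      unfolding H[OF z] cS by (simp add: c_def)
    then have "deep_zero (Suc n) (?H c) z"
      unfolding deep[OF z] cS using d(3) by blast
    moreover have "\<exists>j\<le>Suc n. c j \<noteq> 0"
      using d(1,2) by (intro exI[of _ "Suc j"]) (simp add: cS)
    ultimately show "z \<in> deep_zero_set \<Omega> (Suc n) G"
      using z unfolding deep_zero_set_def by blast
  qed
  ultimately show "E \<in> Zn \<Omega> (Suc n) X"
    unfolding Zn_def using G by blast
qed

section \<open>Equality of the two collections\<close>

theorem theorem5p1:
  fixes \<Omega> :: "complex set" and X :: "(complex \<Rightarrow> complex) set" and n :: nat
  assumes "domain_set \<Omega>"
    and "X \<subseteq> Hol \<Omega>"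
    and "n > 0"
    and "is_algebra \<Omega> X"
    and "(\<lambda>z\<in>\<Omega>. 1) \<in> X"
    and "deriv_set \<Omega> X = X"
  shows "Zn \<Omega> n X = Z \<Omega> X"
proof
  show "Zn \<Omega> n X \<subseteq> Z \<Omega> X"
    using assms by (intro Zn_subset_Z) auto
  have "Zn \<Omega> k X \<subseteq> Zn \<Omega> (Suc k) X" for k
    using assms by (intro Zn_subset_Zn_Suc) (auto simp: domain_set_def)
  then have "Zn \<Omega> 0 X \<subseteq> Zn \<Omega> n X"
    by (rule lift_Suc_mono_le) simp
  then show "Z \<Omega> X \<subseteq> Zn \<Omega> n X"
    by (simp add: Z_def)
qed

end
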